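(* For every fixed integer $r>7$, not all binary matroids of rank at most $r$ can be obtained from $P_r$ using the operations of complementation, local complementation, and switching; that is, there is a matroid $M\in\mathcal{M}_r$ that cannot be obtained from $P_r$ by any finite sequence of these operations.
   Context: $P_r=PG(r-1,2)$ is the rank-$r$ binary projective geometry, i.e. the simple binary matroid on the nonzero vectors of $GF(2)^r$. $\mathcal{M}_r$ is the set of all restrictions of the fixed matroid $P_r$ (to arbitrary subsets of $E(P_r)$). All binary matroids considered are simple, and a binary matroid of rank at most $r$ is regarded as a member of $\mathcal{M}_r$ (every simple binary matroid of rank at most $r$ is isomorphic to a member of $\mathcal{M}_r$). For $M\in\mathcal{M}_r$ and $A\subseteq E(P_r)$, $M\triangle A$ denotes the restriction of $P_r$ to the symmetric difference $E(M)\bigtriangleup A$, and $\mathrm{cl}_{P_r}$ is closure in $P_r$. Operations on $\mathcal{M}_r$: complementation $\omega(M)=M\triangle E(P_r)$; and, for each cocircuit $C^*$ of $P_r$, switching $\sigma_{C^*}(M)=M\triangle C^*$ and local complementation $\lambda_{C^*}(M)=M\triangle[\mathrm{cl}_{P_r}(E(M)\cap C^* )-C^*]$. These may be used with respect to any cocircuit $C^*$ of $P_r$. *)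

theory Defs
  imports "HOL-Analysis.Cartesian_Space" "HOL-Library.Z2"
begin

section \<open>Matroids\<close>

record 'a matroid =
  ground :: "'a set"
  indep :: "'a set set"

definition is_matroid :: "'a matroid \<Rightarrow> bool" where
  "is_matroid M \<longleftrightarrow>
     finite (ground M) \<and>
     indep M \<subseteq> Pow (ground M) \<and>
     {} \<in> indep M \<and>
     (\<forall>I\<in>indep M. \<forall>J. J \<subseteq> I \<longrightarrow> J \<in> indep M) \<and>
     (\<forall>I\<in>indep M. \<forall>J\<in>indep M. card I < card J \<longrightarrow> (\<exists>x\<in>J - I. insert x I \<in> indep M))"

definition restriction :: "'a matroid \<Rightarrow> 'a set \<Rightarrow> 'a matroid" where
  "restriction M X = \<lparr>ground = ground M \<inter> X, indep = {I \<in> indep M. I \<subseteq> X}\<rparr>"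

definition rank :: "'a matroid \<Rightarrow> 'a set \<Rightarrow> nat" where
  "rank M X = Max {card I | I. I \<in> indep M \<and> I \<subseteq> X}"

definition closure_in :: "'a matroid \<Rightarrow> 'a set \<Rightarrow> 'a set" where
  "closure_in M X = {e \<in> ground M. rank M (insert e X) = rank M X}"

definition circuit :: "'a matroid \<Rightarrow> 'a set \<Rightarrow> bool" where
  "circuit M C \<longleftrightarrow> C \<subseteq> ground M \<and> C \<notin> indep M \<and> (\<forall>D. D \<subset> C \<longrightarrow> D \<in> indep M)"

definition basis :: "'a matroid \<Rightarrow> 'a set \<Rightarrow> bool" where
  "basis M B \<longleftrightarrow> B \<in> indep M \<and> (\<forall>I\<in>indep M. B \<subseteq> I \<longrightarrow> I = B)"

definition dual :: "'a matroid \<Rightarrow> 'a matroid" where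
  "dual M = \<lparr>ground = ground M, indep = {I. I \<subseteq> ground M \<and> (\<exists>B. basis M B \<and> I \<inter> B = {})}\<rparr>"

definition cocircuit :: "'a matroid \<Rightarrow> 'a set \<Rightarrow> bool" where
  "cocircuit M C \<longleftrightarrow> circuit (dual M) C"

section \<open>The binary projective geometry and its restrictions\<close>

text \<open>The rank \<open>r\<close> is the cardinality of the index type \<open>'n\<close>, so that \<open>GF(2)\<^sup>r\<close> is the type
  \<open>bit ^ 'n\<close>. The constants with prefix \<open>vec\<close> refer to the scalar field \<open>bit\<close>.\<close>

definition PG :: "(bit ^ 'n) matroid" where
  "PG = \<lparr>ground = UNIV - {0}, indep = {I. vec.independent I}\<rparr>"

text \<open>This is \<open>\<M>\<^sub>r\<close>: labelled restrictions of one fixed copy of \<open>P\<^sub>r\<close>, compared by equality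
  and not up to isomorphism.\<close>

definition PG_restrictions :: "(bit ^ 'n) matroid set" where
  "PG_restrictions = {restriction PG X | X. X \<subseteq> ground PG}"

definition symdiff :: "(bit ^ 'n) matroid \<Rightarrow> (bit ^ 'n) set \<Rightarrow> (bit ^ 'n) matroid" where
  "symdiff M A = restriction PG (sym_diff (ground M) A)"

definition complementation :: "(bit ^ 'n) matroid \<Rightarrow> (bit ^ 'n) matroid" where
  "complementation M = symdiff M (ground PG)"

definition switching :: "(bit ^ 'n) set \<Rightarrow> (bit ^ 'n) matroid \<Rightarrow> (bit ^ 'n) matroid" where
  "switching C M = symdiff M C"

definition local_complementation :: "(bit ^ 'n) set \<Rightarrow> (bit ^ 'n) matroid \<Rightarrow> (bit ^ 'n) matroid" where
  "local_complementation C M = symdiff M (closure_in PG (ground M \<inter> C) - C)"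

inductive operation_step :: "(bit ^ 'n) matroid \<Rightarrow> (bit ^ 'n) matroid \<Rightarrow> bool" where
  complement: "operation_step M (complementation M)"
| switch: "cocircuit PG C \<Longrightarrow> operation_step M (switching C M)"
| local_complement: "cocircuit PG C \<Longrightarrow> operation_step M (local_complementation C M)"

definition obtainable_from :: "(bit ^ 'n) matroid \<Rightarrow> (bit ^ 'n) matroid \<Rightarrow> bool" where
  "obtainable_from N M \<longleftrightarrow> operation_step\<^sup>*\<^sup>* N M"

section \<open>Well-formedness\<close>

instance bit :: finite
proof
  have "UNIV \<subseteq> {0, 1 :: bit}" by (auto intro: bit.exhaust)
  then show "finite (UNIV :: bit set)" by (rule finite_subset) simp
qed

lemma is_matroid_PG: "is_matroid (PG :: (bit ^ 'n) matroid)"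
proof -
  have "\<exists>x\<in>J - I. vec.independent (insert x I)"
    if I: "vec.independent I" and J: "vec.independent J" and c: "card I < card J"
    for I J :: "(bit ^ 'n) set"
  proof -
    have "\<not> J \<subseteq> vec.span I"
      using vec.independent_span_bound[OF finite J] c by fastforce
    then show ?thesis
      using I vec.span_base vec.independent_insertI by blast
  qed
  then show ?thesis
    unfolding is_matroid_def PG_def
    by (auto simp: vec.independent_empty dest: vec.dependent_zero intro: vec.dependent_mono)
qed

lemma is_matroid_restriction:
  assumes "is_matroid M"
  shows "is_matroid (restriction M X)"
  using assms unfolding is_matroid_def restriction_def
  by (auto 0 3 simp: subset_iff)

end

theory Submission
  imports Defs "HOL-Library.Countable"
begin

text \<open>Identify a restriction of \<open>P\<^sub>r\<close> with the indicator function of its ground set on the nonzero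
  vectors. If \<open>E(M) \<inter> C\<close> spans, local complementation at \<open>C\<close> adds all points outside \<open>C\<close>, so it acts
  as switching followed by complementation. Let \<open>q\<close> be the elementary symmetric quadratic form. Its
  polar form vanishes on no subspace of codimension at most two when \<open>r > 7\<close>, so no function \<open>q + affine\<close>
  vanishes on a set \<open>\<phi> = \<psi> = 1\<close> with \<open>\<phi>, \<psi>\<close> nonzero functionals, which is exactly the spanning
  property above. Hence the functions \<open>q + affine\<close> can be reached only from each other,
  whereas \<open>P\<^sub>r\<close> corresponds to a constant.\<close>

section \<open>The elementary symmetric quadratic form\<close>

text \<open>The index type carries no order; \<open>to_nat\<close> only serves to count each
  unordered pair of coordinates once.\<close>

definition quad :: "bit ^ 'n::finite \<Rightarrow> bit" where
  "quad v = (\<Sum>i\<in>UNIV. \<Sum>j | to_nat i < to_nat j. v $ i * v $ j)"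

definition polar :: "bit ^ 'n::finite \<Rightarrow> bit ^ 'n \<Rightarrow> bit" where
  "polar x y = (\<Sum>i\<in>UNIV. \<Sum>j | to_nat i < to_nat j. x $ i * y $ j + x $ j * y $ i)"

text \<open>Checked monomial by monomial. The second difference of a quadratic form does not depend
  on the base point \<open>u\<close>, and it kills affine functions, so it can be evaluated on any
  coset of a subspace.\<close>

lemma quad_second_difference:
  "quad (u + x + y) - quad (u + x) - quad (u + y) + quad u = polar x y"
proof -
  have "(a + b + c) * (a' + b' + c') - (a + b) * (a' + b') - (a + c) * (a' + c') + a * a'
      = b * c' + b' * c" for a b c a' b' c' :: bit
    by algebra
  then show ?thesis
    unfolding quad_def polar_def
    by (simp only: sum_subtractf[symmetric] sum.distrib[symmetric] vector_add_component)
qed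

lemma polar_add_left: "polar (x + x') y = polar x y + polar x' y"
  unfolding polar_def
  by (simp only: sum.distrib[symmetric]) (simp only: vector_add_component algebra_simps)

lemma polar_add_right: "polar x (y + y') = polar x y + polar x y'"
  unfolding polar_def
  by (simp only: sum.distrib[symmetric]) (simp only: vector_add_component algebra_simps)

text \<open>In the standard basis the Gram matrix is all ones off the diagonal and zero on it, so by
  biadditivity values of \<open>polar\<close> become parities of counts of pairs of distinct
  indices.\<close>

lemma polar_axis: "polar (axis i 1) (axis j 1) = (if i = j then 0 else 1)"
proof -
  have axis_sum: "(\<Sum>a\<in>UNIV. \<Sum>b | to_nat a < to_nat b. axis i 1 $ a * axis j 1 $ b :: bit)
      = (if to_nat i < to_nat j then 1 else 0)" for i j :: 'a
  proof -
    have "(\<Sum>a\<in>UNIV. \<Sum>b | to_nat a < to_nat b. axis i 1 $ a * axis j 1 $ b :: bit)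
        = (\<Sum>a\<in>UNIV. if a = i then if to_nat i < to_nat j then 1 else 0 else 0)"
    proof (rule sum.cong[OF refl])
      fix a :: 'a
      have "(\<Sum>b | to_nat a < to_nat b. axis i 1 $ a * axis j 1 $ b :: bit)
          = (\<Sum>b | to_nat a < to_nat b. if b = j then axis i 1 $ a else 0)"
        by (rule sum.cong) (auto simp: axis_def)
      also have "\<dots> = (if a = i then if to_nat i < to_nat j then 1 else 0 else 0)"
        by (subst sum.delta) (auto simp: axis_def)
      finally show "(\<Sum>b | to_nat a < to_nat b. axis i 1 $ a * axis j 1 $ b :: bit)
          = (if a = i then if to_nat i < to_nat j then 1 else 0 else 0)" .
    qed
    also have "\<dots> = (if to_nat i < to_nat j then 1 else 0)"
      by (subst sum.delta) auto
    finally show ?thesis .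
  qed
  have "polar (axis i 1) (axis j 1)
      = (if to_nat i < to_nat j then 1 else 0) + (if to_nat j < to_nat i then 1 else 0)"
    unfolding polar_def sum.distrib axis_sum[symmetric] by (simp only: mult.commute)
  moreover have "i \<noteq> j \<Longrightarrow> to_nat i < to_nat j \<or> to_nat j < to_nat i"
    by (metis inj_to_nat injD linorder_neqE_nat)
  ultimately show ?thesis by auto
qed

text \<open>Pigeonhole on the four possible values of the pair \<open>\<phi>\<close>,
  \<open>\<psi>\<close> on standard basis vectors. Two vectors of value (0, 0) serve directly; from
  three vectors with equal values, pairwise sums lie in both kernels.\<close>

lemma polar_nonzero_on_codim_2:
  fixes \<phi> \<psi> :: "bit ^ 'n::finite \<Rightarrow> bit"
  assumes "CARD('n) > 7" "additive \<phi>" "additive \<psi>"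
  obtains x y where "\<phi> x = 0" "\<psi> x = 0" "\<phi> y = 0" "\<psi> y = 0" "polar x y = 1"
proof -
  interpret \<phi>: additive \<phi> by fact
  interpret \<psi>: additive \<psi> by fact
  define A where "A s t = {i. \<phi> (axis i 1) = s \<and> \<psi> (axis i 1) = t}" for s t
  have "UNIV = A 0 0 \<union> (A 0 1 \<union> (A 1 0 \<union> A 1 1))"
    by (auto simp: A_def)
  then have "CARD('n) = card (A 0 0 \<union> (A 0 1 \<union> (A 1 0 \<union> A 1 1)))"
    by simp
  then have "CARD('n) \<le> card (A 0 0) + (card (A 0 1) + (card (A 1 0) + card (A 1 1)))"
    using card_Un_le[of "A 0 0" "A 0 1 \<union> (A 1 0 \<union> A 1 1)"]
      card_Un_le[of "A 0 1" "A 1 0 \<union> A 1 1"] card_Un_le[of "A 1 0" "A 1 1"] by linarith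
  \<comment> \<open>Otherwise there would be at most 1 + 2 + 2 + 2 = 7 indices; this is where the
    bound on the rank enters.\<close>
  then have "card (A 0 0) \<ge> 2 \<or> card (A 0 1) \<ge> 3 \<or> card (A 1 0) \<ge> 3 \<or> card (A 1 1) \<ge> 3"
    using assms(1) by linarith
  then consider "card (A 0 0) \<ge> 2" | s t where "card (A s t) \<ge> 3"
    by blast
  then show thesis
  proof cases
    case 1
    then obtain T where "T \<subseteq> A 0 0" "card T = 2"
      by (meson obtain_subset_with_card_n)
    then obtain i j where "i \<in> A 0 0" "j \<in> A 0 0" "i \<noteq> j"
      by (auto simp: card_2_iff)
    then show thesis
      by (intro that[of "axis i 1" "axis j 1"]) (auto simp: A_def polar_axis)
  next
    case 2
    then obtain T where "T \<subseteq> A s t" "card T = 3"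
      by (meson obtain_subset_with_card_n)
    then obtain i j k where "i \<in> A s t" "j \<in> A s t" "k \<in> A s t" "i \<noteq> j" "i \<noteq> k" "j \<noteq> k"
      by (auto simp: card_3_iff)
    \<comment> \<open>Expanding \<open>polar\<close> on these two sums gives 0 + 1 + 1 + 1 =
      1.\<close>
    then show thesis
      by (intro that[of "axis i 1 + axis j 1" "axis i 1 + axis k 1"])
        (auto simp: A_def \<phi>.add \<psi>.add polar_add_left polar_add_right polar_axis)
  qed
qed

text \<open>Along directions \<open>x\<close>, \<open>y\<close> in both kernels with
  \<open>polar x y = 1\<close>, the values at the four corners of the parallelogram at
  \<open>u\<close> sum to 1, so they cannot all vanish.\<close>

lemma quad_plus_affine_nonzero:
  fixes \<phi> \<psi> f :: "bit ^ 'n::finite \<Rightarrow> bit"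
  assumes "CARD('n) > 7" "additive \<phi>" "additive \<psi>" "additive f" "\<phi> u = 1" "\<psi> u = 1"
  obtains v where "\<phi> v = 1" "\<psi> v = 1" "quad v + f v + c = 1"
proof -
  interpret \<phi>: additive \<phi> by fact
  interpret \<psi>: additive \<psi> by fact
  interpret f: additive f by fact
  obtain x y where xy: "\<phi> x = 0" "\<psi> x = 0" "\<phi> y = 0" "\<psi> y = 0" "polar x y = 1"
    using polar_nonzero_on_codim_2 assms by metis
  define g where "g v = quad v + f v + c" for v
  have "g (u + x + y) - g (u + x) - g (u + y) + g u
      = quad (u + x + y) - quad (u + x) - quad (u + y) + quad u"
    unfolding g_def f.add by (simp only: algebra_simps)
  also have "\<dots> = 1"
    using quad_second_difference xy(5) by metis
  finally have "\<exists>v\<in>{u + x + y, u + x, u + y, u}. g v = 1"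
    by (cases "g (u + x + y)"; cases "g (u + x)"; cases "g (u + y)"; cases "g u") auto
  moreover have "\<phi> v = 1 \<and> \<psi> v = 1" if "v \<in> {u + x + y, u + x, u + y, u}" for v
    using that xy assms(5,6) by (auto simp: \<phi>.add \<psi>.add)
  ultimately show thesis
    using that unfolding g_def by blast
qed

section \<open>Functionals and cocircuits of the projective geometry\<close>

lemma separating_functional:
  fixes S :: "(bit ^ 'n::finite) set"
  assumes "a \<notin> vec.span S"
  obtains \<psi> :: "bit ^ 'n \<Rightarrow> bit" where "additive \<psi>" "\<psi> a = 1" "\<And>v. v \<in> S \<Longrightarrow> \<psi> v = 0"
proof -
  obtain B where B: "B \<subseteq> S" "vec.independent B" "S \<subseteq> vec.span B"
    by (rule vec.maximal_independent_subset)
  have aB: "a \<notin> vec.span B"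
    using assms vec.span_mono[OF B(1)] by blast
  then have "vec.independent (insert a B)"
    using B(2) by (simp add: vec.independent_insertI)
  \<comment> \<open>The value \<open>1\<close> at \<open>a\<close> is the all-ones vector, so any
    coordinate of \<open>g\<close>, such as the arbitrary one at \<open>undefined\<close>, is a
    suitable functional.\<close>
  then obtain g :: "bit ^ 'n \<Rightarrow> bit ^ 'n" where g: "Vector_Spaces.linear (*s) (*s) g"
      "\<forall>x\<in>insert a B. g x = (if x = a then 1 else 0)"
    using vec.linear_independent_extend[of _ "\<lambda>x. if x = a then 1 else 0"] by blast
  have "a \<notin> B"
    using aB vec.span_base by blast
  then have "g v = 0" if "v \<in> B" for v
    using g(2) that by auto
  then have "g v = 0" if "v \<in> S" for v
    using vec.linear_eq_0_on_span[OF g(1)] that B(3) by blast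
  moreover have "additive (\<lambda>v. g v $ undefined)"
    by (simp add: additive_def vec.linear_add[OF g(1)])
  moreover have "g a = 1"
    using g(2) by simp
  ultimately show thesis
    using that[of "\<lambda>v. g v $ undefined"] by simp
qed

lemma basis_PG_span:
  assumes "basis PG B"
  shows "vec.span B = UNIV"
proof -
  have B: "vec.independent B" "\<And>I. vec.independent I \<Longrightarrow> B \<subseteq> I \<Longrightarrow> I = B"
    using assms by (auto simp: basis_def PG_def)
  have "v \<in> vec.span B" for v
    using B vec.independent_insertI[of v B] vec.span_base by blast
  then show ?thesis by auto
qed

lemma spanning_imp_basis:
  assumes "vec.span Y = UNIV"
  obtains B where "B \<subseteq> Y" "basis PG B"
proof -
  obtain B where B: "B \<subseteq> Y" "vec.independent B" "Y \<subseteq> vec.span B"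
    by (rule vec.maximal_independent_subset)
  have span: "vec.span B = UNIV"
    using assms vec.span_minimal[OF B(3) vec.subspace_span] by auto
  have "I = B" if I: "vec.independent I" "B \<subseteq> I" for I
  proof (rule ccontr)
    assume "I \<noteq> B"
    then obtain x where x: "x \<in> I" "x \<notin> B" using I(2) by blast
    then have "x \<in> vec.span (I - {x})"
      using span vec.span_mono[of B "I - {x}"] I(2) by blast
    then show False using I(1) x(1) unfolding vec.dependent_def by blast
  qed
  then have "basis PG B"
    using B(2) by (auto simp: basis_def PG_def)
  with B(1) that show thesis by blast
qed

text \<open>A cocircuit is a minimal set meeting every basis. Its complement therefore does not span
  and is killed by some nonzero functional; the support of that functional lies in the cocircuit and
  still meets every basis, so minimality forces equality.\<close>

lemma cocircuit_PG:
  fixes C :: "(bit ^ 'n::finite) set"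
  assumes "cocircuit PG C"
  obtains \<phi> :: "bit ^ 'n \<Rightarrow> bit" and w where "additive \<phi>" "\<phi> w = 1" "C = {v. \<phi> v = 1}"
proof -
  have C: "C \<subseteq> ground PG" "\<And>B. basis PG B \<Longrightarrow> C \<inter> B \<noteq> {}"
    and min: "\<And>D. D \<subset> C \<Longrightarrow> \<exists>B. basis PG B \<and> D \<inter> B = {}"
    using assms by (auto simp: cocircuit_def circuit_def dual_def)
  have "vec.span (ground PG - C) \<noteq> UNIV"
  proof
    assume "vec.span (ground PG - C) = UNIV"
    then obtain B where "B \<subseteq> ground PG - C" "basis PG B"
      by (rule spanning_imp_basis)
    with C(2) show False by blast
  qed
  then obtain w where "w \<notin> vec.span (ground PG - C)" by blast
  then obtain \<phi> :: "bit ^ 'n \<Rightarrow> bit"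
    where \<phi>: "additive \<phi>" "\<phi> w = 1" "\<And>v. v \<in> ground PG - C \<Longrightarrow> \<phi> v = 0"
    using separating_functional by blast
  interpret \<phi>: additive \<phi> by fact
  have sub: "{v. \<phi> v = 1} \<subseteq> C"
  proof
    fix v assume v: "v \<in> {v. \<phi> v = 1}"
    then have "v \<in> ground PG"
      using \<phi>.zero by (auto simp: PG_def)
    with v show "v \<in> C" using \<phi>(3)[of v] by auto
  qed
  have "{v. \<phi> v = 1} \<inter> B \<noteq> {}" if "basis PG B" for B
  proof
    assume "{v. \<phi> v = 1} \<inter> B = {}"
    then have "B \<subseteq> {v. \<phi> v = 0}" by auto
    \<comment> \<open>Since 0 and 1 are the only scalars, additivity alone makes the kernel a
      subspace.\<close>
    moreover have "vec.subspace {v. \<phi> v = 0}"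
      unfolding vec.subspace_def
    proof (intro conjI ballI allI)
      fix c v assume "v \<in> {v. \<phi> v = 0}"
      then show "c *s v \<in> {v. \<phi> v = 0}" by (cases c) (auto simp: \<phi>.zero)
    qed (auto simp: \<phi>.zero \<phi>.add)
    ultimately have "vec.span B \<subseteq> {v. \<phi> v = 0}" by (rule vec.span_minimal)
    then have "w \<in> {v. \<phi> v = 0}" using basis_PG_span[OF that] by blast
    then show False using \<phi>(2) by simp
  qed
  then have "C = {v. \<phi> v = 1}"
    using sub min by blast
  with \<phi> that show thesis by blast
qed

section \<open>Rank and closure of spanning sets\<close>

lemma rank_PG_spanning:
  fixes Y :: "(bit ^ 'n::finite) set"
  assumes "B \<subseteq> Y" "basis PG B"
  shows "rank PG Y = card B"
proof -
  have B: "vec.independent B" "vec.span B = UNIV"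
    using assms basis_PG_span by (auto simp: basis_def PG_def)
  have "card I \<le> card B" if "vec.independent I" for I :: "(bit ^ 'n) set"
    using vec.independent_span_bound[OF finite that, of B] B by auto
  then show ?thesis
    unfolding rank_def using assms B by (intro Max_eqI) (auto simp: PG_def)
qed

lemma closure_in_PG_spanning:
  assumes "vec.span Y = UNIV"
  shows "closure_in PG Y = ground PG"
proof -
  obtain B where "B \<subseteq> Y" "basis PG B"
    using assms by (rule spanning_imp_basis)
  then have "rank PG (insert e Y) = rank PG Y" for e
    by (metis rank_PG_spanning subset_insertI2)
  then show ?thesis by (auto simp: closure_in_def)
qed

section \<open>Affine translates of the quadratic form\<close>

definition quad_translate :: "(bit ^ 'n::finite) set \<Rightarrow> bool" where
  "quad_translate X \<longleftrightarrow> (\<exists>f c. additive f \<and> X = {v. v \<noteq> 0 \<and> quad v + f v + c = 1})"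

text \<open>If the span were proper, a nonzero \<open>\<psi>\<close> would vanish on it, and
  \<open>quad\<close> plus an affine function would be zero wherever \<open>\<phi>\<close> and
  \<open>\<psi>\<close> are both 1.\<close>

lemma quad_translate_span:
  fixes X :: "(bit ^ 'n::finite) set" and \<phi> :: "bit ^ 'n \<Rightarrow> bit"
  assumes "CARD('n) > 7" "quad_translate X" "additive \<phi>" "\<phi> w = 1"
  shows "vec.span (X \<inter> {v. \<phi> v = 1}) = UNIV"
proof (rule ccontr)
  assume "vec.span (X \<inter> {v. \<phi> v = 1}) \<noteq> UNIV"
  then obtain a where "a \<notin> vec.span (X \<inter> {v. \<phi> v = 1})" by blast
  then obtain \<psi> :: "bit ^ 'n \<Rightarrow> bit"
    where \<psi>: "additive \<psi>" "\<psi> a = 1" "\<And>v. v \<in> X \<inter> {v. \<phi> v = 1} \<Longrightarrow> \<psi> v = 0"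
    using separating_functional by blast
  obtain f c where f: "additive f" "X = {v. v \<noteq> 0 \<and> quad v + f v + c = 1}"
    using assms(2) unfolding quad_translate_def by blast
  \<comment> \<open>If neither \<open>w\<close> nor \<open>a\<close> works, then
    \<open>\<psi> w = 0\<close> and \<open>\<phi> a = 0\<close>, so \<open>w + a\<close>
    does.\<close>
  have "\<exists>u\<in>{w, a, w + a}. \<phi> u = 1 \<and> \<psi> u = 1"
    using assms(4) \<psi>(2) by (cases "\<phi> a"; cases "\<psi> w")
      (auto simp: additive.add[OF assms(3)] additive.add[OF \<psi>(1)])
  then obtain u where u: "\<phi> u = 1" "\<psi> u = 1" by blast
  obtain v where v: "\<phi> v = 1" "\<psi> v = 1" "quad v + f v + c = 1"
    by (rule quad_plus_affine_nonzero[OF assms(1,3) \<psi>(1) f(1) u])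
  have "v \<noteq> 0"
    using v(1) additive.zero[OF assms(3)] by auto
  with v f(2) \<psi>(3) show False by auto
qed

text \<open>Symmetric difference adds indicator functions modulo 2, and adding \<open>h + d\<close>
  a second time undoes the first.\<close>

lemma quad_translate_sym_diff:
  fixes h :: "bit ^ 'n::finite \<Rightarrow> bit"
  assumes "quad_translate (sym_diff X {v. v \<noteq> 0 \<and> h v + d = 1})" "additive h" "0 \<notin> X"
  shows "quad_translate X"
proof -
  obtain f c where f: "additive f"
      "sym_diff X {v. v \<noteq> 0 \<and> h v + d = 1} = {v. v \<noteq> 0 \<and> quad v + f v + c = 1}"
    using assms(1) unfolding quad_translate_def by blast
  have "v \<in> X \<longleftrightarrow> v \<noteq> 0 \<and> quad v + (f v + h v) + (c + d) = 1" for v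
  proof (cases "v = 0")
    case False
    then have "(v \<in> X) \<noteq> (h v + d = 1) \<longleftrightarrow> quad v + f v + c = 1"
      using f(2) by blast
    then show ?thesis
      using False by (cases "quad v"; cases "f v"; cases c; cases "h v"; cases d) auto
  qed (use assms(3) in auto)
  moreover have "additive (\<lambda>v. f v + h v)"
    by (intro additive.intro)
      (simp only: additive.add[OF f(1)] additive.add[OF assms(2)] ac_simps)
  ultimately show ?thesis
    unfolding quad_translate_def by (intro exI[of _ "\<lambda>v. f v + h v"] exI[of _ "c + d"]) auto
qed

section \<open>Invariance under the three operations\<close>

lemma ground_symdiff:
  assumes "ground M \<subseteq> ground PG" "A \<subseteq> ground PG"
  shows "ground (symdiff M A) = sym_diff (ground M) A"
  using assms by (auto simp: symdiff_def restriction_def)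

text \<open>The property is pulled back from result to source. The added indicator functions are 1
  for complementation, \<open>\<phi>\<close> for switching and \<open>\<phi> + 1\<close> for local
  complementation.\<close>

lemma quad_translate_operation_step:
  fixes M N :: "(bit ^ 'n::finite) matroid"
  assumes "CARD('n) > 7" "operation_step M N" "ground M \<subseteq> ground PG" "quad_translate (ground N)"
  shows "quad_translate (ground M)"
  using assms(2)
proof cases
  case complement
  have "ground PG = {v :: bit ^ 'n. v \<noteq> 0 \<and> 0 + 1 = (1 :: bit)}"
    by (auto simp: PG_def)
  then show ?thesis
    using quad_translate_sym_diff[where X = "ground M" and h = "\<lambda>_. 0" and d = 1] complement assms(3,4)
    by (auto simp: complementation_def ground_symdiff PG_def additive_def)
next
  case (switch C)
  obtain \<phi> :: "bit ^ 'n \<Rightarrow> bit" and w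
    where \<phi>: "additive \<phi>" "\<phi> w = 1" "C = {v. \<phi> v = 1}"
    using cocircuit_PG[OF switch(2)] by blast
  have C: "C = {v. v \<noteq> 0 \<and> \<phi> v + 0 = 1}"
    using \<phi>(3) additive.zero[OF \<phi>(1)] by auto
  then have "C \<subseteq> ground PG" by (auto simp: PG_def)
  then have "ground N = sym_diff (ground M) C"
    using switch(1) assms(3) by (simp add: switching_def ground_symdiff)
  then show ?thesis
    using quad_translate_sym_diff[where X = "ground M" and h = \<phi> and d = 0] assms(3,4) \<phi>(1) C
    by (auto simp: PG_def)
next
  case (local_complement C)
  obtain \<phi> :: "bit ^ 'n \<Rightarrow> bit" and w
    where \<phi>: "additive \<phi>" "\<phi> w = 1" "C = {v. \<phi> v = 1}"
    using cocircuit_PG[OF local_complement(2)] by blast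
  have "closure_in PG (ground M \<inter> C) - C \<subseteq> ground PG"
    by (auto simp: closure_in_def)
  then have N: "ground N = sym_diff (ground M) (closure_in PG (ground M \<inter> C) - C)"
    using local_complement(1) assms(3) by (simp add: local_complementation_def ground_symdiff)
  \<comment> \<open>The closure is taken in \<open>M\<close>, while the spanning property is known
    for \<open>N\<close>; it transfers because local complementation changes nothing on
    \<open>C\<close>.\<close>
  then have "ground M \<inter> C = ground N \<inter> C" by blast
  then have "closure_in PG (ground M \<inter> C) = ground PG"
    using closure_in_PG_spanning quad_translate_span[OF assms(1,4) \<phi>(1,2)] \<phi>(3) by metis
  moreover have "ground PG - C = {v. v \<noteq> 0 \<and> \<phi> v + 1 = 1}"
    using \<phi>(3) by (auto simp: PG_def)
  ultimately show ?thesis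
    using quad_translate_sym_diff[where X = "ground M" and h = \<phi> and d = 1] N assms(3,4) \<phi>(1)
    by (auto simp: PG_def)
qed

theorem theorem5p3:
  assumes "CARD('n::finite) > 7"
  shows "\<exists>M \<in> (PG_restrictions :: (bit ^ 'n) matroid set). \<not> obtainable_from PG M"
proof -
  have "\<not> quad_translate (ground (PG :: (bit ^ 'n) matroid))"
  proof
    assume "quad_translate (ground (PG :: (bit ^ 'n) matroid))"
    then obtain f c where f: "additive f"
        "ground PG = {v :: bit ^ 'n. v \<noteq> 0 \<and> quad v + f v + c = 1}"
      unfolding quad_translate_def by blast
    have nz: "quad v + f v + c = 1" if "v \<noteq> 0" for v :: "bit ^ 'n"
    proof -
      have "v \<in> ground PG"
        using that by (simp add: PG_def)
      then show ?thesis
        unfolding f(2) by simp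
    qed
    \<comment> \<open>The same coordinate functional is used twice; the constant
      \<open>c + 1\<close> produces a nonzero point where \<open>quad + f + c\<close> is 0.\<close>
    define \<phi> :: "bit ^ 'n \<Rightarrow> bit" where "\<phi> v = v $ undefined" for v
    have "additive \<phi>" "\<phi> 1 = 1" by (auto simp: \<phi>_def additive_def)
    then obtain v where v: "\<phi> v = 1" "quad v + f v + (c + 1) = 1"
      using quad_plus_affine_nonzero[OF assms \<open>additive \<phi>\<close> \<open>additive \<phi>\<close> f(1)] by blast
    then have "v \<noteq> 0" by (auto simp: \<phi>_def)
    then show False using nz[of v] v(2) by (simp flip: add.assoc)
  qed
  \<comment> \<open>By contraposition of the pull-back, not being a translate propagates forward
    along every sequence of operations starting at \<open>PG\<close>.\<close>
  moreover have "\<not> quad_translate (ground M) \<and> ground M \<subseteq> ground PG"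
    if "obtainable_from PG M" "\<not> quad_translate (ground (PG :: (bit ^ 'n) matroid))"
    for M :: "(bit ^ 'n) matroid"
    using that(1) unfolding obtainable_from_def
  proof (induction rule: rtranclp_induct)
    case (step M N)
    have "ground N \<subseteq> ground PG"
      using step(2) by cases
        (auto simp: complementation_def switching_def local_complementation_def symdiff_def
          restriction_def)
    with step quad_translate_operation_step[OF assms] show ?case by blast
  qed (use that(2) in auto)
  \<comment> \<open>The unreachable matroid is the support of \<open>quad\<close> itself, the
    translate with \<open>f\<close> and \<open>c\<close> zero.\<close>
  moreover define X where "X = {v :: bit ^ 'n. v \<noteq> 0 \<and> quad v = 1}"
  have X: "X \<subseteq> ground PG" by (auto simp: X_def PG_def)
  then have ground_X: "ground (restriction PG X) = X" by (auto simp: restriction_def)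
  have "quad_translate X"
    unfolding quad_translate_def X_def
    by (intro exI[of _ "\<lambda>_. 0"] exI[of _ 0]) (simp add: additive_def)
  ultimately have "\<not> obtainable_from PG (restriction PG X)"
    using ground_X by metis
  then show ?thesis
    using X unfolding PG_restrictions_def by blast
qed

end
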